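(* Suppose that a finite group $G$ satisfies the $(\mu,\lambda)$-property. Then, for every positive integer $t$, $$\sum_{[H] \in \mathcal C(G)}\lambda(H,G)\left(\frac{|H|^{t-1}\,|G|\,|G' H|}{|G' N_G(H)|}-\Bigl|\bigcup_{g\in G}(H^g)^t\Bigr|\right)=0.$$
   Context: The Möbius function of a finite poset $P$ is the map $\mu_P:P\times P\to\mathbb Z$ with $\mu_P(x,y)=0$ unless $x\leq y$, $\mu_P(x,x)=1$, and $\sum_{x\leq z\leq y}\mu_P(x,z)=0$ for $x<y$. For a finite group $G$, $\mu$ denotes the Möbius function of the lattice of subgroups of $G$. $\mathcal C(G)$ denotes the poset of $G$-conjugacy classes $[H]$ of subgroups $H\leq G$, ordered by $[H]\leq [K]$ if $H\leq K^g$ for some $g\in G$; $\lambda$ denotes its Möbius function, and $\lambda(H,K)=\lambda([H],[K])$. $G'$ is the derived subgroup of $G$, and $(H^g)^t\subseteq G^t$ is the $t$-fold Cartesian power of $H^g$. A finite group $G$ satisfies the $(\mu,\lambda)$-property if, for every subgroup $H\leq G$, $$\mu(H,G)=|N_{G'}(H):G'\cap H|\cdot\lambda(H,G),$$ where $N_{G'}(H)=N_G(H)\cap G'$. *)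

theory Defs
  imports Complex_Main "HOL-Algebra.Algebra"
begin

text \<open>
  A poset is a carrier set \<open>P\<close> with \<^term>\<open>partial_order_on P r\<close>; in particular \<open>r \<subseteq> P \<times> P\<close>,
  so the first clause also forces the value \<open>0\<close> outside \<open>P \<times> P\<close>, which makes the function
  unique as a total HOL function (lemma \<open>ex1_is_moebius\<close>).
\<close>

definition is_moebius :: "'a set \<Rightarrow> 'a rel \<Rightarrow> ('a \<Rightarrow> 'a \<Rightarrow> int) \<Rightarrow> bool" where
  "is_moebius P r m \<longleftrightarrow>
     (\<forall>x y. (x, y) \<notin> r \<longrightarrow> m x y = 0) \<and>
     (\<forall>x\<in>P. m x x = 1) \<and>
     (\<forall>x y. (x, y) \<in> r \<and> x \<noteq> y \<longrightarrow> (\<Sum>z | z \<in> P \<and> (x, z) \<in> r \<and> (z, y) \<in> r. m x z) = 0)"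

definition moebius :: "'a set \<Rightarrow> 'a rel \<Rightarrow> 'a \<Rightarrow> 'a \<Rightarrow> int" where
  "moebius P r = (THE m. is_moebius P r m)"

lemma ex1_is_moebius:
  assumes fin: "finite P" and po: "partial_order_on P r"
  shows "\<exists>!m. is_moebius P r m"
proof -
  have sub: "r \<subseteq> P \<times> P" and rfl: "\<And>x. x \<in> P \<Longrightarrow> (x, x) \<in> r"
    and tr: "trans r" and anti: "antisym r"
    using partial_order_onD[OF po] by (auto simp: refl_on_def)
  define S where "S = r - Id"
  have "trans S" using trans_diff_Id[OF tr anti] by (simp add: S_def)
  moreover have "finite S"
    using sub fin by (auto simp: S_def intro: finite_subset[of _ "P \<times> P"])
  ultimately have wf: "wf S"
    by (intro finite_acyclic_wf) (auto simp: acyclic_def S_def)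
  have split: "(\<Sum>z | z \<in> P \<and> (x, z) \<in> r \<and> (z, y) \<in> r. m x z) =
      m x y + (\<Sum>z | z \<in> P \<and> (x, z) \<in> r \<and> (z, y) \<in> S. m x z)"
    if "(x, y) \<in> r" for x y and m :: "'a \<Rightarrow> 'a \<Rightarrow> int"
  proof -
    have "{z. z \<in> P \<and> (x, z) \<in> r \<and> (z, y) \<in> r} =
        insert y {z. z \<in> P \<and> (x, z) \<in> r \<and> (z, y) \<in> S}"
      using that sub rfl by (auto simp: S_def)
    moreover have "y \<notin> {z. z \<in> P \<and> (x, z) \<in> r \<and> (z, y) \<in> S}" by (simp add: S_def)
    moreover have "finite {z. z \<in> P \<and> (x, z) \<in> r \<and> (z, y) \<in> S}" using fin by simp
    ultimately show ?thesis by simp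
  qed
  show ?thesis
  proof (rule ex_ex1I)
    define F where "F x g y = (if (x, y) \<notin> r then 0 else if x = y then 1
        else - (\<Sum>z | z \<in> P \<and> (x, z) \<in> r \<and> (z, y) \<in> S. g z :: int))" for x g y
    define m where "m x = wfrec S (F x)" for x
    have m: "m x y = F x (m x) y" for x y
    proof -
      have "m x y = F x (cut (m x) S y) y"
        unfolding m_def by (rule wfrec[OF wf])
      also have "\<dots> = F x (m x) y"
        by (auto simp: F_def cut_def intro!: sum.cong)
      finally show ?thesis .
    qed
    show "\<exists>m. is_moebius P r m"
    proof
      show "is_moebius P r m"
        unfolding is_moebius_def
      proof (intro conjI allI ballI impI)
        fix x y assume "(x, y) \<notin> r"
        then show "m x y = 0" by (subst m) (simp add: F_def)
      next
        fix x assume "x \<in> P"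
        then show "m x x = 1" using rfl by (subst m) (simp add: F_def)
      next
        fix x y assume xy: "(x, y) \<in> r \<and> x \<noteq> y"
        then have "m x y = - (\<Sum>z | z \<in> P \<and> (x, z) \<in> r \<and> (z, y) \<in> S. m x z)"
          by (subst m) (simp add: F_def)
        then show "(\<Sum>z | z \<in> P \<and> (x, z) \<in> r \<and> (z, y) \<in> r. m x z) = 0"
          using xy by (simp add: split)
      qed
    qed
  next
    fix m m' assume m: "is_moebius P r m" and m': "is_moebius P r m'"
    have "m x y = m' x y" for x y
    proof (induction y rule: wf_induct_rule[OF wf])
      case (1 y)
      show ?case
      proof (cases "(x, y) \<in> r \<and> x \<noteq> y")
        case True
        have "(\<Sum>z | z \<in> P \<and> (x, z) \<in> r \<and> (z, y) \<in> S. m x z) =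
            (\<Sum>z | z \<in> P \<and> (x, z) \<in> r \<and> (z, y) \<in> S. m' x z)"
          using 1 by (intro sum.cong) auto
        moreover have "(\<Sum>z | z \<in> P \<and> (x, z) \<in> r \<and> (z, y) \<in> r. m x z) = 0"
          "(\<Sum>z | z \<in> P \<and> (x, z) \<in> r \<and> (z, y) \<in> r. m' x z) = 0"
          using m m' True by (auto simp: is_moebius_def)
        ultimately show ?thesis using True by (simp add: split)
      next
        case False
        then consider "(x, y) \<notin> r" | "x = y" "x \<in> P" using sub by blast
        then show ?thesis
        proof cases
          case 1
          then show ?thesis using m m' unfolding is_moebius_def by metis
        next
          case 2
          then show ?thesis using m m' unfolding is_moebius_def by metis
        qed
      qed
    qed
    then show "m = m'" by blast
  qed
qed

lemma is_moebius_moebius: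
  assumes "finite P" "partial_order_on P r"
  shows "is_moebius P r (moebius P r)"
  unfolding moebius_def by (rule theI'[OF ex1_is_moebius[OF assms]])

definition subgroups_of :: "('a, 'b) monoid_scheme \<Rightarrow> 'a set set" where
  "subgroups_of G = {H. subgroup H G}"

definition subgroup_order :: "('a, 'b) monoid_scheme \<Rightarrow> 'a set rel" where
  "subgroup_order G = {(H, K). subgroup H G \<and> subgroup K G \<and> H \<subseteq> K}"

definition subgroup_mu :: "('a, 'b) monoid_scheme \<Rightarrow> 'a set \<Rightarrow> 'a set \<Rightarrow> int" where
  "subgroup_mu G = moebius (subgroups_of G) (subgroup_order G)"

definition conj_subgroup :: "('a, 'b) monoid_scheme \<Rightarrow> 'a set \<Rightarrow> 'a \<Rightarrow> 'a set" where
  "conj_subgroup G H g = inv\<^bsub>G\<^esub> g <#\<^bsub>G\<^esub> H #>\<^bsub>G\<^esub> g"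

definition conj_class :: "('a, 'b) monoid_scheme \<Rightarrow> 'a set \<Rightarrow> 'a set set" where
  "conj_class G H = {conj_subgroup G H g | g. g \<in> carrier G}"

definition conj_classes :: "('a, 'b) monoid_scheme \<Rightarrow> 'a set set set" where
  "conj_classes G = conj_class G ` subgroups_of G"

definition conj_class_order :: "('a, 'b) monoid_scheme \<Rightarrow> 'a set set rel" where
  "conj_class_order G = {(conj_class G H, conj_class G K) | H K.
     subgroup H G \<and> subgroup K G \<and> (\<exists>g\<in>carrier G. H \<subseteq> conj_subgroup G K g)}"

definition subgroup_lambda :: "('a, 'b) monoid_scheme \<Rightarrow> 'a set \<Rightarrow> 'a set \<Rightarrow> int" where
  "subgroup_lambda G H K =
     moebius (conj_classes G) (conj_class_order G) (conj_class G H) (conj_class G K)"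

lemma partial_order_subgroup_order: "partial_order_on (subgroups_of G) (subgroup_order G)"
  unfolding partial_order_on_def preorder_on_def subgroups_of_def subgroup_order_def
  by (auto intro!: refl_onI transI antisymI)

lemma finite_subgroups_of:
  assumes "finite (carrier G)"
  shows "finite (subgroups_of G)"
  by (rule finite_subset[of _ "Pow (carrier G)"])
    (auto simp: subgroups_of_def assms dest: subgroup.subset)

lemma finite_conj_classes:
  assumes "finite (carrier G)"
  shows "finite (conj_classes G)"
  by (simp add: conj_classes_def finite_subgroups_of assms)

context group
begin

lemma conj_subgroup_image:
  "conj_subgroup G H g = (\<lambda>h. inv g \<otimes> h \<otimes> g) ` H"
  by (auto simp: conj_subgroup_def l_coset_def r_coset_def)

lemma conj_subgroup_mult:
  assumes "H \<subseteq> carrier G" "g \<in> carrier G" "k \<in> carrier G"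
  shows "conj_subgroup G (conj_subgroup G H g) k = conj_subgroup G H (g \<otimes> k)"
  unfolding conj_subgroup_image image_image
  using assms by (intro image_cong) (auto simp: inv_mult_group m_assoc subset_iff)

lemma conj_subgroup_one: "H \<subseteq> carrier G \<Longrightarrow> conj_subgroup G H \<one> = H"
  unfolding conj_subgroup_image by (force simp: subset_iff)

lemma conj_subgroup_subset:
  "H \<subseteq> carrier G \<Longrightarrow> g \<in> carrier G \<Longrightarrow> conj_subgroup G H g \<subseteq> carrier G"
  unfolding conj_subgroup_image by auto

lemma conj_subgroup_mono: "H \<subseteq> K \<Longrightarrow> conj_subgroup G H g \<subseteq> conj_subgroup G K g"
  unfolding conj_subgroup_image by auto

lemma card_conj_subgroup:
  assumes "H \<subseteq> carrier G" "g \<in> carrier G"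
  shows "card (conj_subgroup G H g) = card H"
  unfolding conj_subgroup_image
proof (rule card_image, rule inj_onI)
  fix x y assume "x \<in> H" "y \<in> H" "inv g \<otimes> x \<otimes> g = inv g \<otimes> y \<otimes> g"
  then show "x = y" using assms by (auto simp: subset_iff m_assoc)
qed

lemma conj_class_conj_subgroup:
  assumes "H \<subseteq> carrier G" "g \<in> carrier G"
  shows "conj_class G (conj_subgroup G H g) = conj_class G H"
proof
  show "conj_class G (conj_subgroup G H g) \<subseteq> conj_class G H"
    using assms by (auto simp: conj_class_def conj_subgroup_mult)
  show "conj_class G H \<subseteq> conj_class G (conj_subgroup G H g)"
  proof
    fix K assume "K \<in> conj_class G H"
    then obtain k where k: "k \<in> carrier G" "K = conj_subgroup G H k"
      by (auto simp: conj_class_def)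
    have "conj_subgroup G (conj_subgroup G H g) (inv g \<otimes> k) = K"
      using assms k by (simp add: conj_subgroup_mult m_assoc[symmetric])
    then show "K \<in> conj_class G (conj_subgroup G H g)"
      using assms k by (auto simp: conj_class_def)
  qed
qed

lemma conj_class_eq_iff:
  assumes "H \<subseteq> carrier G" "K \<subseteq> carrier G"
  shows "conj_class G H = conj_class G K \<longleftrightarrow> (\<exists>g\<in>carrier G. H = conj_subgroup G K g)"
proof
  assume "conj_class G H = conj_class G K"
  moreover have "H \<in> conj_class G H"
    using conj_subgroup_one[OF assms(1)] unfolding conj_class_def by force
  ultimately show "\<exists>g\<in>carrier G. H = conj_subgroup G K g"
    unfolding conj_class_def by auto
qed (use conj_class_conj_subgroup assms in auto)

text \<open>The order does not depend on the chosen representatives.\<close>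

lemma conj_class_order_iff:
  assumes H: "subgroup H G" and K: "subgroup K G"
  shows "(conj_class G H, conj_class G K) \<in> conj_class_order G \<longleftrightarrow>
    (\<exists>g\<in>carrier G. H \<subseteq> conj_subgroup G K g)"
proof
  assume "(conj_class G H, conj_class G K) \<in> conj_class_order G"
  then obtain H' K' g where *: "subgroup H' G" "subgroup K' G" "g \<in> carrier G"
    "conj_class G H = conj_class G H'" "conj_class G K' = conj_class G K"
    "H' \<subseteq> conj_subgroup G K' g"
    by (auto simp: conj_class_order_def)
  then obtain a b where ab: "a \<in> carrier G" "H = conj_subgroup G H' a"
    "b \<in> carrier G" "K' = conj_subgroup G K b"
    using conj_class_eq_iff H K subgroup.subset by metis
  have "H \<subseteq> conj_subgroup G (conj_subgroup G (conj_subgroup G K b) g) a"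
    using conj_subgroup_mono[OF *(6)] ab by simp
  also have "\<dots> = conj_subgroup G K (b \<otimes> g \<otimes> a)"
    using ab *(3) K by (simp add: conj_subgroup_mult conj_subgroup_subset subgroup.subset m_assoc)
  finally show "\<exists>g\<in>carrier G. H \<subseteq> conj_subgroup G K g"
    using ab *(3) by blast
qed (use assms in \<open>auto simp: conj_class_order_def\<close>)

lemma partial_order_conj_class_order:
  assumes fin: "finite (carrier G)"
  shows "partial_order_on (conj_classes G) (conj_class_order G)"
  unfolding partial_order_on_def preorder_on_def
proof (intro conjI)
  show "conj_class_order G \<subseteq> conj_classes G \<times> conj_classes G"
    by (auto simp: conj_class_order_def conj_classes_def subgroups_of_def)
  show "refl_on (conj_classes G) (conj_class_order G)"
  proof (rule refl_onI)
    fix C assume "C \<in> conj_classes G"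
    then obtain H where H: "subgroup H G" "C = conj_class G H"
      by (auto simp: conj_classes_def subgroups_of_def)
    then show "(C, C) \<in> conj_class_order G"
      using conj_subgroup_one[OF subgroup.subset[OF H(1)]]
      by (auto simp: conj_class_order_iff intro!: bexI[of _ \<one>])
  qed
  show "trans (conj_class_order G)"
  proof (rule transI)
    fix A B C assume AB: "(A, B) \<in> conj_class_order G" and BC: "(B, C) \<in> conj_class_order G"
    from AB obtain H K g where HK: "subgroup H G" "subgroup K G" "g \<in> carrier G"
      "A = conj_class G H" "B = conj_class G K" "H \<subseteq> conj_subgroup G K g"
      by (auto simp: conj_class_order_def)
    from BC obtain L where L: "subgroup L G" "C = conj_class G L"
      by (auto simp: conj_class_order_def)
    then obtain k where k: "k \<in> carrier G" "K \<subseteq> conj_subgroup G L k"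
      using BC HK conj_class_order_iff by blast
    have "H \<subseteq> conj_subgroup G (conj_subgroup G L k) g"
      using HK(6) conj_subgroup_mono[OF k(2)] by blast
    then have "H \<subseteq> conj_subgroup G L (k \<otimes> g)"
      using L HK k by (simp add: conj_subgroup_mult subgroup.subset)
    then show "(A, C) \<in> conj_class_order G"
      using HK L k by (auto simp: conj_class_order_iff)
  qed
  show "antisym (conj_class_order G)"
  proof (rule antisymI)
    fix A B assume AB: "(A, B) \<in> conj_class_order G" and BA: "(B, A) \<in> conj_class_order G"
    from AB obtain H K g where HK: "subgroup H G" "subgroup K G" "g \<in> carrier G"
      "A = conj_class G H" "B = conj_class G K" "H \<subseteq> conj_subgroup G K g"
      by (auto simp: conj_class_order_def)
    then obtain k where k: "k \<in> carrier G" "K \<subseteq> conj_subgroup G H k"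
      using BA conj_class_order_iff by blast
    have sub: "H \<subseteq> carrier G" "K \<subseteq> carrier G" using HK subgroup.subset by auto
    have "finite (conj_subgroup G L x)" if "L \<subseteq> carrier G" "x \<in> carrier G" for L x
      using conj_subgroup_subset[OF that] fin finite_subset by blast
    then have "card H \<le> card K" "card K \<le> card H" "finite (conj_subgroup G K g)"
      using card_mono[OF _ HK(6)] card_mono[OF _ k(2)] sub HK k by (auto simp: card_conj_subgroup)
    then have "H = conj_subgroup G K g"
      using card_subset_eq[OF _ HK(6)] sub HK by (simp add: card_conj_subgroup)
    then show "A = B" using HK sub by (simp add: conj_class_conj_subgroup)
  qed
qed

end

text \<open>
  The index of a subgroup is its number of right cosets in the group \<open>N\<^bsub>G'\<^esub>(H)\<close>, obtained from
  \<open>G\<close> by shrinking the carrier.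
\<close>

definition mu_lambda_property :: "('a, 'b) monoid_scheme \<Rightarrow> bool" where
  "mu_lambda_property G \<longleftrightarrow> (\<forall>H. subgroup H G \<longrightarrow>
     subgroup_mu G H (carrier G) =
       int (card (rcosets\<^bsub>G\<lparr>carrier := normalizer G H \<inter> derived G (carrier G)\<rparr>\<^esub>
                    (derived G (carrier G) \<inter> H)))
       * subgroup_lambda G H (carrier G))"

end

theory Submission
  imports Defs
begin

text \<open>
  Both sides of the difference count the \<open>t\<close>-tuples that generate \<open>G\<close>. Sorting the tuples by the
  subgroup they generate, Moebius inversion in the subgroup lattice gives
  \<open>\<Sum>\<^sub>H \<mu>(H,G) |H|\<^sup>t\<close>, and Moebius inversion in \<open>\<C>(G)\<close> gives
  \<open>\<Sum>\<^bsub>[H]\<^esub> \<lambda>(H,G) |\<Union>\<^sub>g (H\<^sup>g)\<^sup>t|\<close>. Collecting the first sum by conjugacy classes, of size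
  \<open>|G : N(H)|\<close>, and inserting the \<open>(\<mu>,\<lambda>)\<close>-property turns it into the remaining sum, because
  \<open>|N(H) \<inter> G'|\<close> and \<open>|G' \<inter> H|\<close> are given by the product formula.
\<close>

section \<open>Moebius functions of finite posets\<close>

text \<open>The defining recursion of \<open>moebius\<close> sums over the second argument, whereas
  inversion from above needs the sum over the first. In the incidence algebra the two recursions say
  left and right inverse of the zeta function, and such inverses coincide.\<close>

lemma is_moebius_dual:
  assumes fin: "finite P" and po: "partial_order_on P r"
    and x: "x \<in> P" and y: "y \<in> P"
  shows "(\<Sum>z | z \<in> P \<and> (x, z) \<in> r \<and> (z, y) \<in> r. moebius P r z y) = (if x = y then 1 else 0)"
proof -
  define m where "m = moebius P r"
  \<comment> \<open>The Moebius function of the dual order with its arguments swapped: its recursion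
    runs over the first argument.\<close>
  define m' where "m' a b = moebius P (r\<inverse>) b a" for a b
  have m: "is_moebius P r m"
    unfolding m_def by (rule is_moebius_moebius[OF fin po])
  have po': "partial_order_on P (r\<inverse>)"
    using po by simp
  have m': "is_moebius P (r\<inverse>) (moebius P (r\<inverse>))"
    by (rule is_moebius_moebius[OF fin po'])
  have refl: "(a, a) \<in> r" if "a \<in> P" for a
    using partial_order_onD(1)[OF po] that by (auto simp: refl_on_def)
  have trans: "(a, c) \<in> r" if "(a, b) \<in> r" "(b, c) \<in> r" for a b c
    using partial_order_onD(2)[OF po] that by (meson transD)
  have antisym: "a = b" if "(a, b) \<in> r" "(b, a) \<in> r" for a b
    using partial_order_onD(3)[OF po] that by (meson antisymD)
  have zero: "m a b = 0" "m' a b = 0" if "(a, b) \<notin> r" for a b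
    using m m' that unfolding is_moebius_def m'_def by auto
  \<comment> \<open>Sums over intervals become sums over all of \<open>P\<close>, so that the double
    sum below can be swapped.\<close>
  have interval: "(\<Sum>z | z \<in> P \<and> (a, z) \<in> r \<and> (z, b) \<in> r. f z) =
      (\<Sum>z\<in>P. if (a, z) \<in> r \<and> (z, b) \<in> r then f z else 0)" for a b and f :: "'a \<Rightarrow> int"
    using fin by (simp add: sum.If_cases Int_def)
  have left: "(\<Sum>z\<in>P. if (a, z) \<in> r \<and> (z, b) \<in> r then m a z else 0) = (if a = b then 1 else 0)"
    if "a \<in> P" "b \<in> P" for a b
  proof (cases "(a, b) \<in> r \<and> a \<noteq> b")
    case True
    then show ?thesis using m unfolding is_moebius_def interval[symmetric] by simp
  next
    case False
    \<comment> \<open>Either \<open>a = b\<close> and the interval is the single point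
      \<open>a\<close>, or \<open>a\<close> is not below \<open>b\<close> and the interval is
      empty.\<close>
    have "(\<Sum>z\<in>P. if (a, z) \<in> r \<and> (z, b) \<in> r then m a z else 0) =
      (\<Sum>z\<in>P. if z = a then (if a = b then 1 else 0) else 0)"
      using False m refl that unfolding is_moebius_def
      by (intro sum.cong) (auto dest: trans antisym)
    then show ?thesis using fin that by simp
  qed
  have right: "(\<Sum>z\<in>P. if (a, z) \<in> r \<and> (z, b) \<in> r then m' z b else 0) = (if a = b then 1 else 0)"
    if "a \<in> P" "b \<in> P" for a b
  proof (cases "(a, b) \<in> r \<and> a \<noteq> b")
    case True
    then have "(b, a) \<in> r\<inverse> \<and> b \<noteq> a" by auto
    then have "(\<Sum>z | z \<in> P \<and> (b, z) \<in> r\<inverse> \<and> (z, a) \<in> r\<inverse>. m' z b) = 0"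
      using m' unfolding is_moebius_def m'_def by blast
    then show ?thesis using True unfolding interval[symmetric] by (simp add: conj_commute)
  next
    case False
    have "(\<Sum>z\<in>P. if (a, z) \<in> r \<and> (z, b) \<in> r then m' z b else 0) =
      (\<Sum>z\<in>P. if z = a then (if a = b then 1 else 0) else 0)"
      using False m' refl that unfolding is_moebius_def m'_def
      by (intro sum.cong) (auto dest: trans antisym)
    then show ?thesis using fin that by simp
  qed
  \<comment> \<open>\<open>m\<close> is a left and \<open>m'\<close> a right inverse of the zeta function, so they agree.\<close>
  have eq: "m a b = m' a b" if ab: "a \<in> P" "b \<in> P" for a b
  proof -
    have "m a b = (\<Sum>z\<in>P. m a z * (if z = b then 1 else 0))"
      using fin ab by (simp add: if_distrib[of "(*) _"] cong: if_cong)
    also have "\<dots> = (\<Sum>z\<in>P. m a z * (\<Sum>w\<in>P. if (z, w) \<in> r \<and> (w, b) \<in> r then m' w b else 0))"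
      using right ab by (intro sum.cong) auto
    \<comment> \<open>The condition on \<open>(w, b)\<close> may be traded for one on
      \<open>(a, z)\<close>, since \<open>m' w b\<close> and \<open>m a z\<close> vanish when these
      pairs lie outside \<open>r\<close>.\<close>
    also have "\<dots> = (\<Sum>z\<in>P. \<Sum>w\<in>P. if (a, z) \<in> r \<and> (z, w) \<in> r then m a z * m' w b else 0)"
      unfolding sum_distrib_left by (intro sum.cong refl) (auto simp: zero)
    also have "\<dots> = (\<Sum>w\<in>P. \<Sum>z\<in>P. if (a, z) \<in> r \<and> (z, w) \<in> r then m a z * m' w b else 0)"
      by (rule sum.swap)
    also have "\<dots> = (\<Sum>w\<in>P. (\<Sum>z\<in>P. if (a, z) \<in> r \<and> (z, w) \<in> r then m a z else 0) * m' w b)"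
      unfolding sum_distrib_right by (intro sum.cong refl) auto
    also have "\<dots> = (\<Sum>w\<in>P. (if a = w then 1 else 0) * m' w b)"
      using left ab by (intro sum.cong) auto
    also have "\<dots> = (\<Sum>w\<in>P. if a = w then m' w b else 0)"
      by (intro sum.cong) auto
    also have "\<dots> = m' a b"
      using fin ab by simp
    finally show ?thesis .
  qed
  have "(\<Sum>z | z \<in> P \<and> (x, z) \<in> r \<and> (z, y) \<in> r. m z y) =
      (\<Sum>z | z \<in> P \<and> (x, z) \<in> r \<and> (z, y) \<in> r. m' z y)"
    using eq y by (intro sum.cong) auto
  also have "\<dots> = (if x = y then 1 else 0)"
    unfolding interval using right x y by simp
  finally show ?thesis unfolding m_def .
qed

text \<open>Each \<open>x\<close> carries a label \<open>k x\<close>, and counts of labels below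
  \<open>z\<close> are turned into the count of the label \<open>y\<close>. After swapping the sums,
  the contribution of a single \<open>x\<close> is the dual recursion on the interval from
  \<open>k x\<close> to the top element \<open>y\<close>, which is 1 if \<open>k x = y\<close> and 0
  otherwise.\<close>

lemma moebius_inversion_count:
  assumes fin: "finite P" and po: "partial_order_on P r"
    and top: "y \<in> P" "\<And>z. z \<in> P \<Longrightarrow> (z, y) \<in> r"
    and S: "finite S" and k: "\<And>x. x \<in> S \<Longrightarrow> k x \<in> P"
  shows "(\<Sum>z\<in>P. moebius P r z y * int (card {x \<in> S. (k x, z) \<in> r})) =
    int (card {x \<in> S. k x = y})"
proof -
  have "(\<Sum>z\<in>P. moebius P r z y * int (card {x \<in> S. (k x, z) \<in> r})) =
      (\<Sum>z\<in>P. \<Sum>x\<in>S. if (k x, z) \<in> r then moebius P r z y else 0)"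
    using S by (simp add: sum.If_cases Int_def mult.commute)
  also have "\<dots> = (\<Sum>x\<in>S. \<Sum>z\<in>P. if (k x, z) \<in> r then moebius P r z y else 0)"
    by (rule sum.swap)
  also have "\<dots> = (\<Sum>x\<in>S. if k x = y then 1 else 0)"
  proof (rule sum.cong[OF refl])
    fix x assume x: "x \<in> S"
    have "(\<Sum>z\<in>P. if (k x, z) \<in> r then moebius P r z y else 0) =
        (\<Sum>z | z \<in> P \<and> (k x, z) \<in> r \<and> (z, y) \<in> r. moebius P r z y)"
      using fin top(2) by (auto simp: sum.If_cases intro!: sum.cong)
    then show "(\<Sum>z\<in>P. if (k x, z) \<in> r then moebius P r z y else 0) = (if k x = y then 1 else 0)"
      using is_moebius_dual[OF fin po k[OF x] top(1)] by simp
  qed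
  also have "\<dots> = int (card {x \<in> S. k x = y})"
    using S by (simp add: sum.If_cases Int_def)
  finally show ?thesis .
qed

text \<open>The Moebius function transported along \<open>f\<close> satisfies the same recursion, so
  uniqueness identifies it with the original.\<close>

lemma moebius_automorphism:
  assumes fin: "finite P" and po: "partial_order_on P r"
    and bij: "bij_betw f P P"
    and mono: "\<And>x y. x \<in> P \<Longrightarrow> y \<in> P \<Longrightarrow> (f x, f y) \<in> r \<longleftrightarrow> (x, y) \<in> r"
    and xy: "x \<in> P" "y \<in> P"
  shows "moebius P r (f x) (f y) = moebius P r x y"
proof -
  define m where "m = moebius P r"
  \<comment> \<open>Nothing is known about \<open>f\<close> outside \<open>P\<close>; the default 0
    is the value that \<open>is_moebius\<close> demands there.\<close>
  define m' where "m' a b = (if a \<in> P \<and> b \<in> P then m (f a) (f b) else 0)" for a b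
  have m: "is_moebius P r m"
    unfolding m_def by (rule is_moebius_moebius[OF fin po])
  have sub: "r \<subseteq> P \<times> P" using po by (auto simp: partial_order_on_def preorder_on_def)
  have fP: "f a \<in> P" if "a \<in> P" for a
    using bij that by (auto simp: bij_betw_def)
  have inj: "f a = f b \<longleftrightarrow> a = b" if "a \<in> P" "b \<in> P" for a b
    using bij that by (auto simp: bij_betw_def inj_on_def)
  have "is_moebius P r m'"
    unfolding is_moebius_def
  proof (intro conjI allI ballI impI)
    fix a b assume "(a, b) \<notin> r"
    then show "m' a b = 0" using m mono unfolding is_moebius_def m'_def by auto
  next
    fix a assume "a \<in> P"
    then show "m' a a = 1" using m fP unfolding is_moebius_def m'_def by auto
  next
    fix a b assume ab: "(a, b) \<in> r \<and> a \<noteq> b"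
    then have P: "a \<in> P" "b \<in> P" using sub by auto
    let ?I = "\<lambda>a b. {z. z \<in> P \<and> (a, z) \<in> r \<and> (z, b) \<in> r}"
    have "?I (f a) (f b) = f ` ?I a b"
    proof
      show "f ` ?I a b \<subseteq> ?I (f a) (f b)" using P mono fP by auto
      show "?I (f a) (f b) \<subseteq> f ` ?I a b"
      proof
        fix w assume w: "w \<in> ?I (f a) (f b)"
        then obtain z where "z \<in> P" "w = f z" using bij by (auto simp: bij_betw_def)
        then show "w \<in> f ` ?I a b" using w P mono by auto
      qed
    qed
    moreover have "inj_on f (?I a b)" using inj by (auto simp: inj_on_def)
    ultimately have "(\<Sum>z\<in>?I (f a) (f b). m (f a) z) = (\<Sum>z\<in>?I a b. m (f a) (f z))"
      by (simp add: sum.reindex)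
    moreover have "(f a, f b) \<in> r \<and> f a \<noteq> f b"
      using ab P mono inj by simp
    then have "(\<Sum>z\<in>?I (f a) (f b). m (f a) z) = 0"
      using m unfolding is_moebius_def by blast
    ultimately show "(\<Sum>z\<in>?I a b. m' a z) = 0"
      using P by (simp add: m'_def)
  qed
  then have "m' = m" using ex1_is_moebius[OF fin po] m by blast
  then have "m' x y = m x y" by simp
  then show ?thesis using xy by (simp add: m'_def m_def)
qed

section \<open>Product formula, conjugation and sums over conjugacy classes\<close>

context group
begin

text \<open>By the second isomorphism theorem \<open>K / (N \<inter> K)\<close> and
  \<open>NK / N\<close> have equal size; Lagrange turns both indices into quotients of
  orders.\<close>

lemma card_normal_set_mult:
  assumes fin: "finite (carrier G)" and N: "N \<lhd> G" and K: "subgroup K G"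
  shows "card (N <#> K) * card (N \<inter> K) = card N * card K"
proof -
  interpret second_isomorphism_grp N G K
    using N K by (simp add: second_isomorphism_grp_def second_isomorphism_grp_axioms_def)
  have "card (carrier (G\<lparr>carrier := K\<rparr> Mod (N \<inter> K))) =
      card (carrier (G\<lparr>carrier := N <#> K\<rparr> Mod N))"
    using normal_intersection_quotient_isom unfolding iso_def
    by (auto intro: bij_betw_same_card)
  then have index: "card (rcosets\<^bsub>G\<lparr>carrier := K\<rparr>\<^esub> (N \<inter> K)) = card (rcosets\<^bsub>G\<lparr>carrier := N <#> K\<rparr>\<^esub> N)"
    by (simp add: FactGroup_def)
  have "subgroup (N \<inter> K) G"
    using K is_subgroup subgroups_Inter_pair by blast
  then have K_eq: "card (rcosets\<^bsub>G\<lparr>carrier := K\<rparr>\<^esub> (N \<inter> K)) * card (N \<inter> K) = card K"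
    using group.lagrange[OF subgroup_imp_group[OF K] subgroup_incl[OF _ K]] by (simp add: order_def)
  have NK_eq: "card (rcosets\<^bsub>G\<lparr>carrier := N <#> K\<rparr>\<^esub> N) * card N = card (N <#> K)"
    using group.lagrange[OF subgroup_imp_group[OF normal_set_mult_subgroup]
        subgroup_incl[OF is_subgroup normal_set_mult_subgroup H_contained_in_set_mult]]
    by (simp add: order_def)
  show ?thesis
    unfolding K_eq[symmetric] NK_eq[symmetric] index by (simp only: ac_simps)
qed

lemma subgroup_conj_subgroup:
  assumes H: "subgroup H G" and g: "g \<in> carrier G"
  shows "subgroup (conj_subgroup G H g) G"
proof (rule subgroupI)
  have sub: "H \<subseteq> carrier G" by (rule subgroup.subset[OF H])
  then show "conj_subgroup G H g \<subseteq> carrier G" using g by (rule conj_subgroup_subset)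
  show "conj_subgroup G H g \<noteq> {}"
    using subgroup.one_closed[OF H] by (auto simp: conj_subgroup_image)
  fix a assume "a \<in> conj_subgroup G H g"
  then obtain h where h: "h \<in> H" "a = inv g \<otimes> h \<otimes> g" by (auto simp: conj_subgroup_image)
  then have "inv a = inv g \<otimes> inv h \<otimes> g"
    using g sub by (simp add: inv_mult_group m_assoc subset_iff)
  then show "inv a \<in> conj_subgroup G H g"
    using subgroup.m_inv_closed[OF H h(1)] by (auto simp: conj_subgroup_image)
  fix b assume "b \<in> conj_subgroup G H g"
  then obtain k where k: "k \<in> H" "b = inv g \<otimes> k \<otimes> g" by (auto simp: conj_subgroup_image)
  have hk: "h \<in> carrier G" "k \<in> carrier G" using h k sub by auto
  have "a \<otimes> b = inv g \<otimes> h \<otimes> (g \<otimes> inv g) \<otimes> k \<otimes> g"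
    using g hk h k by (simp only: m_assoc m_closed inv_closed)
  also have "\<dots> = inv g \<otimes> (h \<otimes> k) \<otimes> g" using g hk by (simp add: m_assoc)
  finally have "a \<otimes> b = inv g \<otimes> (h \<otimes> k) \<otimes> g" .
  then show "a \<otimes> b \<in> conj_subgroup G H g"
    using subgroup.m_closed[OF H h(1) k(1)] by (auto simp: conj_subgroup_image)
qed

lemma conj_subgroup_carrier:
  assumes "finite (carrier G)" "g \<in> carrier G"
  shows "conj_subgroup G (carrier G) g = carrier G"
  using assms by (intro card_subset_eq conj_subgroup_subset) (auto simp: card_conj_subgroup)

lemma conj_subgroup_inv:
  assumes "H \<subseteq> carrier G" "g \<in> carrier G"
  shows "conj_subgroup G (conj_subgroup G H g) (inv g) = H"
    and "conj_subgroup G (conj_subgroup G H (inv g)) g = H"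
  using assms by (simp_all add: conj_subgroup_mult conj_subgroup_one)

text \<open>Conjugation by \<open>g\<close> is an automorphism of the subgroup lattice, with inverse
  conjugation by \<open>inv g\<close>, and it fixes the top element
  \<open>carrier G\<close>.\<close>

lemma subgroup_mu_conj_subgroup:
  assumes fin: "finite (carrier G)" and H: "subgroup H G" and g: "g \<in> carrier G"
  shows "subgroup_mu G (conj_subgroup G H g) (carrier G) = subgroup_mu G H (carrier G)"
proof -
  let ?f = "\<lambda>H. conj_subgroup G H g"
  have "bij_betw ?f (subgroups_of G) (subgroups_of G)"
    using g by (intro bij_betw_byWitness[where f' = "\<lambda>H. conj_subgroup G H (inv g)"])
      (auto simp: subgroups_of_def conj_subgroup_inv subgroup.subset subgroup_conj_subgroup)
  moreover have "(?f A, ?f B) \<in> subgroup_order G \<longleftrightarrow> (A, B) \<in> subgroup_order G"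
    if "A \<in> subgroups_of G" "B \<in> subgroups_of G" for A B
  proof -
    have AB: "subgroup A G" "subgroup B G" using that by (auto simp: subgroups_of_def)
    have "A \<subseteq> B" if "?f A \<subseteq> ?f B"
      using conj_subgroup_mono[OF that, of "inv g"] AB g
      by (simp add: conj_subgroup_inv subgroup.subset)
    then show ?thesis
      using AB g by (auto simp: subgroup_order_def subgroup_conj_subgroup
          dest: subsetD[OF conj_subgroup_mono])
  qed
  ultimately have "subgroup_mu G (?f H) (?f (carrier G)) = subgroup_mu G H (carrier G)"
    unfolding subgroup_mu_def
    by (intro moebius_automorphism finite_subgroups_of fin partial_order_subgroup_order)
      (auto simp: subgroups_of_def H subgroup_self)
  then show ?thesis using conj_subgroup_carrier[OF fin g] by simp
qed

text \<open>Orbit-stabilizer for the conjugation action on subsets, where the normalizer is by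
  definition the stabilizer.\<close>

lemma card_conj_class:
  assumes H: "H \<subseteq> carrier G"
  shows "card (conj_class G H) * card (normalizer G H) = order G"
proof -
  \<comment> \<open>This action uses \<open>g H inv g\<close> while \<open>conj_subgroup\<close>
    uses \<open>inv g H g\<close>; inverting \<open>g\<close> permutes the group, so the orbits
    agree.\<close>
  let ?\<phi> = "\<lambda>g. \<lambda>H\<in>{H. H \<subseteq> carrier G}. g <# H #> inv g"
  have "orbit G ?\<phi> H = (\<lambda>g. ?\<phi> g H) ` carrier G"
    unfolding orbit_def by blast
  also have "\<dots> = (\<lambda>g. conj_subgroup G H (inv g)) ` carrier G"
    using H by (intro image_cong) (simp_all add: conj_subgroup_def)
  also have "\<dots> = conj_class G H"
    unfolding conj_class_def by (auto intro!: image_eqI[where x = "inv _"])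
  finally have orbit: "orbit G ?\<phi> H = conj_class G H" .
  have "card (orbit G ?\<phi> H) * card (stabilizer G ?\<phi> H) = order G"
    using H by (intro group_action.orbit_stabilizer_theorem[OF action_by_conjugation_on_power_set]) simp
  then show ?thesis
    unfolding orbit normalizer_def .
qed

lemma conj_class_rep:
  assumes "C \<in> conj_classes G" "H \<in> C"
  shows "subgroup H G" "conj_class G H = C"
proof -
  obtain K g where K: "subgroup K G" "C = conj_class G K"
    and g: "g \<in> carrier G" "H = conj_subgroup G K g"
    using assms by (auto simp: conj_classes_def subgroups_of_def conj_class_def)
  then show "subgroup H G" "conj_class G H = C"
    by (simp_all add: subgroup_conj_subgroup conj_class_conj_subgroup subgroup.subset)
qed

text \<open>The conjugacy classes partition the set of subgroups, and \<open>f\<close> is constant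
  on each of them.\<close>

lemma sum_conj_classes:
  fixes f :: "'a set \<Rightarrow> 'c::semiring_1"
  assumes fin: "finite (carrier G)"
    and rep: "\<And>C. C \<in> conj_classes G \<Longrightarrow> rep C \<in> C"
    and f: "\<And>H g. subgroup H G \<Longrightarrow> g \<in> carrier G \<Longrightarrow> f (conj_subgroup G H g) = f H"
  shows "(\<Sum>H\<in>subgroups_of G. f H) = (\<Sum>C\<in>conj_classes G. of_nat (card C) * f (rep C))"
proof -
  have Un: "subgroups_of G = \<Union> (conj_classes G)"
  proof (intro equalityI subsetI)
    fix H assume H: "H \<in> subgroups_of G"
    then have "conj_subgroup G H \<one> = H"
      by (simp add: subgroups_of_def subgroup.subset conj_subgroup_one)
    then have "H \<in> conj_class G H"
      unfolding conj_class_def by (intro CollectI exI[of _ \<one>]) simp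
    then show "H \<in> \<Union> (conj_classes G)" using H unfolding conj_classes_def by blast
  next
    fix H assume "H \<in> \<Union> (conj_classes G)"
    then obtain C where "C \<in> conj_classes G" "H \<in> C" by blast
    then show "H \<in> subgroups_of G" unfolding subgroups_of_def by (blast intro: conj_class_rep(1))
  qed
  from this finite_subgroups_of[OF fin] have fC: "finite C" if "C \<in> conj_classes G" for C
    using that by (metis Union_upper finite_subset)
  have "(\<Sum>H\<in>subgroups_of G. f H) = (\<Sum>C\<in>conj_classes G. \<Sum>H\<in>C. f H)"
    unfolding Un
  proof (rule sum.Union_disjoint[unfolded comp_def])
    show "\<forall>A\<in>conj_classes G. \<forall>B\<in>conj_classes G. A \<noteq> B \<longrightarrow> A \<inter> B = {}"
      using conj_class_rep(2) by blast
  qed (use fC in blast)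
  also have "\<dots> = (\<Sum>C\<in>conj_classes G. of_nat (card C) * f (rep C))"
  proof (rule sum.cong[OF refl])
    fix C assume C: "C \<in> conj_classes G"
    have "f H = f (rep C)" if "H \<in> C" for H
    proof -
      have "H \<in> conj_class G (rep C)"
        using conj_class_rep(2)[OF C rep[OF C]] that by simp
      then show ?thesis
        using f conj_class_rep(1)[OF C rep[OF C]] by (auto simp: conj_class_def)
    qed
    then show "(\<Sum>H\<in>C. f H) = of_nat (card C) * f (rep C)" by simp
  qed
  finally show ?thesis .
qed

section \<open>Counting generating tuples in two posets\<close>

text \<open>Links tuples with entries in \<open>H\<close> to the order on subgroups, as both
  inversions require. The first hypothesis also supplies the default value of \<open>x\<close> off
  \<open>I\<close> that membership in the extensional function space on the right needs.\<close>

lemma generate_tuple_subset_iff: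
  assumes "x \<in> I \<rightarrow>\<^sub>E carrier G" "subgroup H G"
  shows "generate G (x ` I) \<subseteq> H \<longleftrightarrow> x \<in> I \<rightarrow>\<^sub>E H"
proof
  assume "generate G (x ` I) \<subseteq> H"
  then show "x \<in> I \<rightarrow>\<^sub>E H"
    using assms(1) generate.incl[of _ "x ` I" G] by (auto simp: PiE_iff)
next
  assume "x \<in> I \<rightarrow>\<^sub>E H"
  then show "generate G (x ` I) \<subseteq> H"
    by (intro generate_subgroup_incl assms(2)) auto
qed

text \<open>Inversion in the subgroup lattice, each tuple being labelled by the subgroup it
  generates: the tuples with label below \<open>H\<close> are those with all entries in
  \<open>H\<close>.\<close>

lemma card_generating_tuples_mu:
  assumes fin: "finite (carrier G)" and I: "finite I"
  shows "(\<Sum>H\<in>subgroups_of G. subgroup_mu G H (carrier G) * int (card H ^ card I)) =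
    int (card {x \<in> I \<rightarrow>\<^sub>E carrier G. generate G (x ` I) = carrier G})"
proof -
  let ?k = "\<lambda>x. generate G (x ` I)"
  have sub: "x ` I \<subseteq> carrier G" if "x \<in> I \<rightarrow>\<^sub>E carrier G" for x
    using that by auto
  have "card {x \<in> I \<rightarrow>\<^sub>E carrier G. (?k x, H) \<in> subgroup_order G} = card H ^ card I"
    if H: "subgroup H G" for H
  proof -
    have "(?k x, H) \<in> subgroup_order G \<longleftrightarrow> x \<in> I \<rightarrow>\<^sub>E H" if "x \<in> I \<rightarrow>\<^sub>E carrier G" for x
      using generate_tuple_subset_iff[OF that H] generate_is_subgroup[OF sub[OF that]] H
      by (simp add: subgroup_order_def)
    then have "{x \<in> I \<rightarrow>\<^sub>E carrier G. (?k x, H) \<in> subgroup_order G} = I \<rightarrow>\<^sub>E H"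
      using PiE_mono[of I "\<lambda>_. H" "\<lambda>_. carrier G"] subgroup.subset[OF H] by blast
    then show ?thesis using I by (simp add: card_PiE)
  qed
  then have "(\<Sum>H\<in>subgroups_of G. subgroup_mu G H (carrier G) * int (card H ^ card I)) =
      (\<Sum>H\<in>subgroups_of G. moebius (subgroups_of G) (subgroup_order G) H (carrier G) *
        int (card {x \<in> I \<rightarrow>\<^sub>E carrier G. (?k x, H) \<in> subgroup_order G}))"
    by (intro sum.cong) (auto simp: subgroup_mu_def subgroups_of_def)
  also have "\<dots> = int (card {x \<in> I \<rightarrow>\<^sub>E carrier G. ?k x = carrier G})"
    using generate_is_subgroup[OF sub]
    by (intro moebius_inversion_count finite_subgroups_of partial_order_subgroup_order fin finite_PiE I)
      (auto simp: subgroups_of_def subgroup_order_def subgroup_self subgroup.subset)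
  finally show ?thesis .
qed

text \<open>Inversion in the poset of classes, each tuple being labelled by the class of the
  subgroup it generates. A label lies below \<open>[H]\<close> exactly when the tuple has all its
  entries in one common conjugate of \<open>H\<close>, which is where the union of Cartesian powers
  comes from.\<close>

lemma card_generating_tuples_lambda:
  assumes fin: "finite (carrier G)" and I: "finite I"
    and rep: "\<And>C. C \<in> conj_classes G \<Longrightarrow> rep C \<in> C"
  shows "(\<Sum>C\<in>conj_classes G. subgroup_lambda G (rep C) (carrier G) *
      int (card (\<Union>g\<in>carrier G. I \<rightarrow>\<^sub>E conj_subgroup G (rep C) g))) =
    int (card {x \<in> I \<rightarrow>\<^sub>E carrier G. generate G (x ` I) = carrier G})"
proof -
  let ?k = "\<lambda>x. generate G (x ` I)"
  let ?c = "\<lambda>x. conj_class G (?k x)"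
  have k: "subgroup (?k x) G" if "x \<in> I \<rightarrow>\<^sub>E carrier G" for x
    using that by (intro generate_is_subgroup) auto
  have above: "(\<Union>g\<in>carrier G. I \<rightarrow>\<^sub>E conj_subgroup G H g) =
      {x \<in> I \<rightarrow>\<^sub>E carrier G. (?c x, conj_class G H) \<in> conj_class_order G}" if H: "subgroup H G" for H
  proof -
    have "(\<exists>g\<in>carrier G. x \<in> I \<rightarrow>\<^sub>E conj_subgroup G H g) \<longleftrightarrow>
        (?c x, conj_class G H) \<in> conj_class_order G" if x: "x \<in> I \<rightarrow>\<^sub>E carrier G" for x
      using generate_tuple_subset_iff[OF x subgroup_conj_subgroup[OF H]]
        conj_class_order_iff[OF k[OF x] H] by simp
    moreover have "(\<Union>g\<in>carrier G. I \<rightarrow>\<^sub>E conj_subgroup G H g) =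
        {x \<in> I \<rightarrow>\<^sub>E carrier G. \<exists>g\<in>carrier G. x \<in> I \<rightarrow>\<^sub>E conj_subgroup G H g}"
      using conj_subgroup_subset[OF subgroup.subset[OF H]]
        PiE_mono[of I "\<lambda>_. conj_subgroup G H _" "\<lambda>_. carrier G"] by blast
    ultimately show ?thesis by blast
  qed
  have top: "(C, conj_class G (carrier G)) \<in> conj_class_order G" if C: "C \<in> conj_classes G" for C
  proof -
    obtain H where H: "subgroup H G" "C = conj_class G H"
      using C by (auto simp: conj_classes_def subgroups_of_def)
    have "H \<subseteq> conj_subgroup G (carrier G) \<one>"
      using subgroup.subset[OF H(1)] by (simp add: conj_subgroup_carrier[OF fin])
    then show ?thesis
      unfolding H(2) conj_class_order_iff[OF H(1) subgroup_self] by blast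
  qed
  have "(\<Sum>C\<in>conj_classes G. subgroup_lambda G (rep C) (carrier G) *
      int (card (\<Union>g\<in>carrier G. I \<rightarrow>\<^sub>E conj_subgroup G (rep C) g))) =
    (\<Sum>C\<in>conj_classes G. moebius (conj_classes G) (conj_class_order G) C (conj_class G (carrier G)) *
      int (card {x \<in> I \<rightarrow>\<^sub>E carrier G. (?c x, C) \<in> conj_class_order G}))"
    using above conj_class_rep[OF _ rep] by (intro sum.cong refl) (simp add: subgroup_lambda_def)
  also have "\<dots> = int (card {x \<in> I \<rightarrow>\<^sub>E carrier G. ?c x = conj_class G (carrier G)})"
    using k top
    by (intro moebius_inversion_count finite_conj_classes partial_order_conj_class_order
        fin finite_PiE I) (auto simp: conj_classes_def subgroups_of_def subgroup_self)
  \<comment> \<open>The whole group is its only conjugate, so the top label is attained exactly by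
    generating tuples.\<close>
  also have "{x \<in> I \<rightarrow>\<^sub>E carrier G. ?c x = conj_class G (carrier G)} =
      {x \<in> I \<rightarrow>\<^sub>E carrier G. ?k x = carrier G}"
  proof (intro Collect_cong conj_cong refl)
    fix x assume "x \<in> I \<rightarrow>\<^sub>E carrier G"
    from conj_class_eq_iff[OF subgroup.subset[OF k[OF this]] order.refl]
    show "?c x = conj_class G (carrier G) \<longleftrightarrow> ?k x = carrier G"
      using conj_subgroup_carrier[OF fin] by blast
  qed
  finally show ?thesis .
qed

section \<open>Contribution of one conjugacy class\<close>

text \<open>Write \<open>D\<close> for the derived subgroup and \<open>N\<close> for the normalizer.
  The class has size \<open>|G| / |N|\<close>, and the factor in the property is
  \<open>|N \<inter> D| / |D \<inter> H|\<close>. The product formula for \<open>DN\<close> and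
  \<open>DH\<close> rewrites this factor as \<open>|N| |DH| / (|DN| |H|)\<close>; then
  \<open>|N|\<close> cancels against the class size and one power of \<open>|H|\<close>
  disappears.\<close>

lemma mu_lambda_term:
  assumes fin: "finite (carrier G)" and ml: "mu_lambda_property G" and H: "subgroup H G" and t: "t > 0"
  shows "real (card (conj_class G H)) * (real_of_int (subgroup_mu G H (carrier G)) * real (card H ^ t)) =
    real_of_int (subgroup_lambda G H (carrier G)) *
      (real (card H ^ (t - 1) * order G * card (derived G (carrier G) <#> H))
        / real (card (derived G (carrier G) <#> normalizer G H)))"
proof -
  let ?D = "derived G (carrier G)" and ?N = "normalizer G H"
  define i where "i = card (rcosets\<^bsub>G\<lparr>carrier := ?N \<inter> ?D\<rparr>\<^esub> (?D \<inter> H))"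
  have D: "?D \<lhd> G" by (rule derived_is_normal[OF normal_self])
  then have Ds: "subgroup ?D G" by (rule normal_imp_subgroup)
  have N: "subgroup ?N G" by (rule normalizer_imp_subgroup[OF subgroup.subset[OF H]])
  have HN: "H \<subseteq> ?N"
    using subgroup.subset[OF normal_imp_subgroup[OF subgroup_in_normalizer[OF H]]] by simp
  have ND: "subgroup (?N \<inter> ?D) G" and DH: "subgroup (?D \<inter> H) G"
    using subgroups_Inter_pair N Ds H by auto
  have index: "i * card (?D \<inter> H) = card (?N \<inter> ?D)"
    using group.lagrange[OF subgroup_imp_group[OF ND] subgroup_incl[OF DH ND]] HN
    by (auto simp: order_def i_def)
  have pos: "card A > 0" if "subgroup A G" for A
    using that fin subgroup.finite_imp_card_positive by blast
  have DN: "subgroup (?D <#> ?N) G" by (rule mult_norm_subgroup[OF D N])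
  have eqN: "card (?D <#> ?N) * card (?N \<inter> ?D) = card ?D * card ?N"
    using card_normal_set_mult[OF fin D N] by (simp add: Int_commute)
  have eqH: "card (?D <#> H) * card (?D \<inter> H) = card ?D * card H"
    by (rule card_normal_set_mult[OF fin D H])
  have eqC: "card (conj_class G H) * card ?N = order G"
    by (rule card_conj_class[OF subgroup.subset[OF H]])
  \<comment> \<open>All relations are kept multiplied out over the naturals; the only division comes
    at the end, by the positive number \<open>card (?D <#> ?N)\<close>.\<close>
  have "card ?D * card H * (card (?D <#> ?N) * i) = card (?D <#> H) * (card (?D <#> ?N) * (i * card (?D \<inter> H)))"
    unfolding eqH[symmetric] by (simp only: ac_simps)
  also have "\<dots> = card (?D <#> H) * (card ?D * card ?N)"
    using index eqN by simp
  finally have "card ?D * (card H * (card (?D <#> ?N) * i)) = card ?D * (card (?D <#> H) * card ?N)"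
    by (simp only: ac_simps)
  then have "card H * (card (?D <#> ?N) * i) = card (?D <#> H) * card ?N"
    using pos[OF Ds] by simp
  \<comment> \<open>With the class size as a factor, orbit-stabilizer can absorb
    \<open>card ?N\<close> into \<open>order G\<close>.\<close>
  then have "card (conj_class G H) * (card H * (card (?D <#> ?N) * i)) =
      card (conj_class G H) * (card (?D <#> H) * card ?N)"
    by (rule arg_cong)
  then have "card (conj_class G H) * i * card H * card (?D <#> ?N) =
      card (conj_class G H) * card ?N * card (?D <#> H)"
    by (simp only: ac_simps)
  also have "\<dots> = order G * card (?D <#> H)" using eqC by simp
  finally have key: "card (conj_class G H) * i * card H * card (?D <#> ?N) =
      order G * card (?D <#> H)" .
  \<comment> \<open>Positivity of \<open>t\<close> is used here: one factor \<open>card H\<close> is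
    split off to match \<open>key\<close>.\<close>
  have "card H ^ t = card H ^ (t - 1) * card H"
    using t by (metis power_minus_mult)
  then have "card (conj_class G H) * i * card H ^ t * card (?D <#> ?N) =
      card H ^ (t - 1) * (card (conj_class G H) * i * card H * card (?D <#> ?N))"
    by (simp only: ac_simps)
  then have "card (conj_class G H) * i * card H ^ t * card (?D <#> ?N) =
      card H ^ (t - 1) * order G * card (?D <#> H)"
    using key by (simp only: mult.assoc)
  then have "real (card (conj_class G H) * i * card H ^ t) * real (card (?D <#> ?N)) =
      real (card H ^ (t - 1) * order G * card (?D <#> H))"
    by (simp only: of_nat_mult [symmetric])
  then have "real (card (conj_class G H) * i * card H ^ t) =
      real (card H ^ (t - 1) * order G * card (?D <#> H)) / real (card (?D <#> ?N))"
    using pos[OF DN] by (simp add: eq_divide_eq)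
  moreover have "subgroup_mu G H (carrier G) = int i * subgroup_lambda G H (carrier G)"
    using ml H unfolding mu_lambda_property_def i_def by blast
  then have "real (card (conj_class G H)) * (real_of_int (subgroup_mu G H (carrier G)) * real (card H ^ t)) =
      real_of_int (subgroup_lambda G H (carrier G)) * real (card (conj_class G H) * i * card H ^ t)"
    by simp
  ultimately show ?thesis by (simp only:)
qed

end

section \<open>The two counts compared\<close>

text \<open>\<open>rep\<close> is an arbitrary choice of one subgroup from each class, so the
  identity holds for every system of representatives. A \<open>t\<close>-tuple is encoded as an
  extensional function on \<open>{..<t}\<close>, and the sum is taken in the reals to allow the
  quotient.\<close>

theorem theorem7:
  fixes G :: "('a, 'b) monoid_scheme" (structure)
    and t :: nat
    and rep :: "'a set set \<Rightarrow> 'a set"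
  assumes "group G"
    and "finite (carrier G)"
    and "mu_lambda_property G"
    and "t > 0"
    and rep: "\<And>C. C \<in> conj_classes G \<Longrightarrow> rep C \<in> C"
  shows "(\<Sum>C\<in>conj_classes G. let H = rep C in
            real_of_int (subgroup_lambda G H (carrier G)) *
            (real (card H ^ (t - 1) * order G * card (derived G (carrier G) <#> H))
               / real (card (derived G (carrier G) <#> normalizer G H))
             - real (card (\<Union>g\<in>carrier G. {..<t} \<rightarrow>\<^sub>E conj_subgroup G H g)))) = 0"
proof -
  interpret group G by fact
  \<comment> \<open>The number of generating \<open>t\<close>-tuples, known as Hall's Eulerian
    function; both halves of the sum are shown to equal it.\<close>
  define \<phi> where "\<phi> = card {x \<in> {..<t} \<rightarrow>\<^sub>E carrier G. generate G (x ` {..<t}) = carrier G}"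
  let ?l = "\<lambda>C. real_of_int (subgroup_lambda G (rep C) (carrier G))"
  let ?A = "\<lambda>C. real (card (rep C) ^ (t - 1) * order G * card (derived G (carrier G) <#> rep C))
               / real (card (derived G (carrier G) <#> normalizer G (rep C)))"
  let ?B = "\<lambda>C. real (card (\<Union>g\<in>carrier G. {..<t} \<rightarrow>\<^sub>E conj_subgroup G (rep C) g))"
  let ?f = "\<lambda>H. real_of_int (subgroup_mu G H (carrier G)) * real (card H ^ t)"
  have "real \<phi> = real_of_int (\<Sum>H\<in>subgroups_of G. subgroup_mu G H (carrier G) * int (card H ^ t))"
    using card_generating_tuples_mu[OF assms(2), of "{..<t}"] by (simp add: \<phi>_def)
  also have "\<dots> = (\<Sum>H\<in>subgroups_of G. ?f H)" by simp
  also have "\<dots> = (\<Sum>C\<in>conj_classes G. real (card C) * ?f (rep C))"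
    using assms(2) rep
    by (intro sum_conj_classes)
      (auto simp: subgroup_mu_conj_subgroup card_conj_subgroup subgroup.subset)
  also have "\<dots> = (\<Sum>C\<in>conj_classes G. ?l C * ?A C)"
  proof (rule sum.cong[OF refl])
    fix C assume C: "C \<in> conj_classes G"
    show "real (card C) * ?f (rep C) = ?l C * ?A C"
      using mu_lambda_term[OF assms(2,3) conj_class_rep(1)[OF C rep[OF C]] assms(4)]
        conj_class_rep(2)[OF C rep[OF C]] by simp
  qed
  finally have A: "(\<Sum>C\<in>conj_classes G. ?l C * ?A C) = real \<phi>" by simp
  have "real_of_int (\<Sum>C\<in>conj_classes G. subgroup_lambda G (rep C) (carrier G) *
      int (card (\<Union>g\<in>carrier G. {..<t} \<rightarrow>\<^sub>E conj_subgroup G (rep C) g))) = real \<phi>"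
    using card_generating_tuples_lambda[OF assms(2) _ rep, of "{..<t}"] by (simp add: \<phi>_def)
  then have B: "(\<Sum>C\<in>conj_classes G. ?l C * ?B C) = real \<phi>" by simp
  show ?thesis
    using A B by (simp only: Let_def right_diff_distrib sum_subtractf diff_self)
qed

end
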